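(* Let $a\geq 1$ and $n>1$ be odd integers. Then for infinitely many primes $p$, the class group of the imaginary quadratic field $K(a,p,n)=\mathbb{Q}(\sqrt{a^2-4p^n})$ has a subgroup isomorphic to $\mathbb{Z}/n\mathbb{Z}$.
   Context: For integers $x\geq 1$, $y\geq 2$, $n\geq 2$, the notation $K(x,y,n)$ denotes the field $\mathbb{Q}(\sqrt{x^2-4y^n})$, considered when it is imaginary quadratic. *)

theory Defs
  imports
    Complex_Main
    "HOL-Algebra.Algebra"
    "HOL-Algebra.Algebraic_Closure_Type"
begin

abbreviation complex_ring :: "complex ring" where
  "complex_ring \<equiv> ring_of_type_algebra"

section \<open>The class group of a number field inside the complex numbers\<close>

definition ring_of_integers :: "complex set \<Rightarrow> complex set" where
  "ring_of_integers K = {x \<in> K. algebraic_int x}"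

text \<open>
  Fractional ideals are nonzero submodules of \<open>K\<close> over the ring of integers that admit a
  common denominator.
\<close>

definition fractional_ideal :: "complex set \<Rightarrow> complex set \<Rightarrow> bool" where
  "fractional_ideal K I \<longleftrightarrow>
     I \<subseteq> K \<and> I \<noteq> {0} \<and> additive_subgroup I complex_ring \<and>
     (\<forall>r \<in> ring_of_integers K. \<forall>x \<in> I. r * x \<in> I) \<and>
     (\<exists>d \<in> ring_of_integers K - {0}. \<forall>x \<in> I. d * x \<in> ring_of_integers K)"

definition principal_fractional_ideal :: "complex set \<Rightarrow> complex \<Rightarrow> complex set" where
  "principal_fractional_ideal K x = (\<lambda>r. x * r) ` ring_of_integers K"

text \<open>
  The operation \<^const>\<open>ideal_prod\<close>, which consists of the finite sums of products, uses only the
  ring operations, so it can be taken in the ambient ring of complex numbers.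
\<close>

definition fractional_ideal_group :: "complex set \<Rightarrow> complex set monoid" where
  "fractional_ideal_group K =
     \<lparr>carrier = {I. fractional_ideal K I}, monoid.mult = ideal_prod complex_ring,
      one = ring_of_integers K\<rparr>"

definition class_group :: "complex set \<Rightarrow> complex set set monoid" where
  "class_group K =
     fractional_ideal_group K Mod {principal_fractional_ideal K x | x. x \<in> K - {0}}"

section \<open>Quadratic fields\<close>

text \<open>
  The subfield generated by a square root of \<open>d\<close>; it contains the rational numbers because the
  characteristic is zero, and it does not depend on the choice of the square root.
\<close>

definition rat_adjoin_sqrt :: "int \<Rightarrow> complex set" where
  "rat_adjoin_sqrt d = generate_field complex_ring {csqrt (of_int d)}"

definition imaginary_quadratic :: "complex set \<Rightarrow> bool" where
  "imaginary_quadratic K \<longleftrightarrow> (\<exists>d. d < 0 \<and> K = rat_adjoin_sqrt d)"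

definition K_field :: "int \<Rightarrow> int \<Rightarrow> nat \<Rightarrow> complex set" where
  "K_field x y n = rat_adjoin_sqrt (x\<^sup>2 - 4 * y ^ n)"

end

theory Submission
  imports Defs
begin

text \<open>
  Put \<open>D = a\<^sup>2 - 4 * p ^ n\<close> and let \<open>\<alpha> = (a + sqrt D) / 2\<close>, an integer of the field with trace \<open>a\<close> and norm
  \<open>p ^ n\<close>. When \<open>p\<close> does not divide \<open>a\<close>, the elements \<open>\<alpha>\<close> and \<open>cnj \<alpha>\<close> generate the unit ideal, so the
  ideal generated by \<open>\<alpha>\<close> is the \<open>n\<close>-th power of the ideal generated by \<open>p\<close> and \<open>\<alpha>\<close> (lemmas \<open>J_pow\<close> and
  \<open>J_n\<close>). The class of the latter ideal therefore has an order dividing \<open>n\<close>.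

  Suppose that the order is a proper divisor \<open>m\<close> of \<open>n\<close>, and let \<open>e = n / m\<close>, an odd number that is at
  least \<open>3\<close>. If the field has no units besides \<open>1\<close> and \<open>- 1\<close>, then \<open>\<alpha> = \<gamma> ^ e\<close> for an integer \<open>\<gamma>\<close> of the
  field, and \<open>\<gamma>\<close> has norm \<open>p ^ m\<close>. The trace of \<open>\<gamma> ^ e\<close> is \<open>u * W (p ^ m)\<close>, where \<open>u\<close> is the trace of \<open>\<gamma>\<close> and
  \<open>W\<close> is a polynomial of degree \<open>(e - 1) / 2 > 0\<close> depending on \<open>u\<close>. Now \<open>a = u * W (p ^ m)\<close> is fixed and
  nonzero: \<open>u\<close> is one of its finitely many divisors, and for each of them \<open>p ^ m\<close> is one of finitely many
  roots (lemma \<open>finite_odd_power_sum_eq\<close>). So only finitely many primes \<open>p\<close> are exceptional.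

  The Gaussian field is excluded by \<open>D\<close> being \<open>1\<close> modulo \<open>4\<close>, and the Eisenstein field by taking \<open>p\<close> to be
  \<open>2\<close> modulo \<open>3\<close>. Every large prime in this residue class then has the desired property, and there are
  infinitely many of them.

  The class group is the quotient of the commutative monoid of fractional ideals by the units that the
  principal ideals form. In it the class of the ideal \<open>J 1\<close> generated by \<open>p\<close> and \<open>\<alpha>\<close> is invertible because
  its \<open>n\<close>-th power is trivial.
\<close>

section \<open>Cyclic subgroups of quotients of commutative monoids\<close>

text \<open>
  A quotient of a commutative monoid by a subgroup of its units multiplies like a quotient of abelian
  groups. The fractional ideals form such a monoid, with the principal ideals as the subgroup, and a
  class is invertible as soon as some power of it is trivial.
\<close>

locale unit_subgroup = comm_monoid G for G (structure) +
  fixes P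
  assumes subset: "P \<subseteq> carrier G"
    and one_in: "\<one> \<in> P"
    and mult_in: "\<And>x y. x \<in> P \<Longrightarrow> y \<in> P \<Longrightarrow> x \<otimes> y \<in> P"
    and inverse_in: "\<And>x. x \<in> P \<Longrightarrow> \<exists>y\<in>P. x \<otimes> y = \<one>"
begin

lemma in_carrier: "x \<in> P \<Longrightarrow> x \<in> carrier G"
  using subset by blast

text \<open>
  Since \<open>P\<close> consists of units with inverses in \<open>P\<close>, its cosets are the orbits of a group action, and two of
  them are equal once they share an element.
\<close>

lemma r_coset_eq_iff:
  assumes x: "x \<in> carrier G" and y: "y \<in> carrier G"
  shows "P #> x = P #> y \<longleftrightarrow> (\<exists>h\<in>P. x = h \<otimes> y)"
proof
  assume "P #> x = P #> y"
  moreover have "x \<in> P #> x"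
    using one_in x by (auto simp: r_coset_def intro!: bexI[of _ \<one>])
  ultimately show "\<exists>h\<in>P. x = h \<otimes> y"
    by (auto simp: r_coset_def)
next
  assume "\<exists>h\<in>P. x = h \<otimes> y"
  then obtain h where h: "h \<in> P" "x = h \<otimes> y" by blast
  obtain k where k: "k \<in> P" "h \<otimes> k = \<one>" using inverse_in h by blast
  have y_eq: "y = k \<otimes> x"
    using h k y in_carrier by (metis m_assoc m_comm l_one)
  show "P #> x = P #> y"
  proof
    show "P #> x \<subseteq> P #> y"
    proof
      fix z assume "z \<in> P #> x"
      then obtain g where g: "g \<in> P" "z = g \<otimes> x" by (auto simp: r_coset_def)
      then have "z = (g \<otimes> h) \<otimes> y" using h y in_carrier by (simp add: m_assoc)
      then show "z \<in> P #> y" using mult_in g h by (auto simp: r_coset_def)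
    qed
    show "P #> y \<subseteq> P #> x"
    proof
      fix z assume "z \<in> P #> y"
      then obtain g where g: "g \<in> P" "z = g \<otimes> y" by (auto simp: r_coset_def)
      then have "z = (g \<otimes> k) \<otimes> x" using k x y_eq in_carrier by (metis m_assoc)
      then show "z \<in> P #> x" using mult_in g k by (auto simp: r_coset_def)
    qed
  qed
qed

lemma r_coset_mult:
  assumes x: "x \<in> carrier G" and y: "y \<in> carrier G"
  shows "(P #> x) <#> (P #> y) = P #> (x \<otimes> y)"
proof
  show "(P #> x) <#> (P #> y) \<subseteq> P #> (x \<otimes> y)"
  proof
    fix z assume "z \<in> (P #> x) <#> (P #> y)"
    then obtain g h where gh: "g \<in> P" "h \<in> P" "z = (g \<otimes> x) \<otimes> (h \<otimes> y)"
      by (auto simp: r_coset_def set_mult_def)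
    then have "z = (g \<otimes> h) \<otimes> (x \<otimes> y)"
      using x y in_carrier by (simp add: m_ac)
    then show "z \<in> P #> (x \<otimes> y)" using mult_in gh by (auto simp: r_coset_def)
  qed
  show "P #> (x \<otimes> y) \<subseteq> (P #> x) <#> (P #> y)"
  proof
    fix z assume "z \<in> P #> (x \<otimes> y)"
    then obtain g where g: "g \<in> P" "z = g \<otimes> (x \<otimes> y)" by (auto simp: r_coset_def)
    then have "z = (g \<otimes> x) \<otimes> (\<one> \<otimes> y)" using x y in_carrier by (simp add: m_assoc)
    then show "z \<in> (P #> x) <#> (P #> y)"
      using g one_in unfolding r_coset_def set_mult_def by blast
  qed
qed

lemma r_coset_one: "P #> \<one> = P"
  using in_carrier by (auto simp: r_coset_def)

text \<open>
  This determines inverses in the quotient uniquely, which is what the closure of a subgroup under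
  \<^const>\<open>m_inv\<close> depends on.
\<close>

lemma monoid_Mod: "monoid (G Mod P)"
proof (rule monoidI)
  show "\<one>\<^bsub>G Mod P\<^esub> \<in> carrier (G Mod P)"
    using r_coset_one by (force simp: carrier_FactGroup)
qed (use r_coset_mult r_coset_mult[of \<one>] r_coset_mult[of _ \<one>] r_coset_one
      in \<open>auto simp: carrier_FactGroup m_assoc\<close>)

lemma mem_iff_of_mult_mem:
  assumes x: "x \<in> carrier G" and h: "h \<in> P"
  shows "h \<otimes> x \<in> P \<longleftrightarrow> x \<in> P"
proof
  assume hx: "h \<otimes> x \<in> P"
  obtain k where k: "k \<in> P" "h \<otimes> k = \<one>" using inverse_in h by blast
  have "x = k \<otimes> (h \<otimes> x)" using k h x in_carrier by (metis m_assoc m_comm l_one)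
  then show "x \<in> P" using mult_in k hx by metis
qed (use mult_in h in blast)

lemma pow_mem: "x \<in> P \<Longrightarrow> x [^] (k::nat) \<in> P"
  by (induction k) (auto simp: one_in mult_in)

text \<open>
  The exponents whose power lies in \<open>P\<close> are closed under taking remainders, so they are the multiples
  of the least positive one. That one divides \<open>n\<close>, hence it is \<open>n\<close> as soon as the proper divisors are
  excluded.
\<close>

lemma pow_mem_iff_dvd:
  assumes g: "g \<in> carrier G" and n: "0 < n" and gn: "g [^] n \<in> P"
    and proper: "\<And>m. 0 < m \<Longrightarrow> m < n \<Longrightarrow> m dvd n \<Longrightarrow> g [^] m \<notin> P"
  shows "g [^] (k::nat) \<in> P \<longleftrightarrow> n dvd k"
proof -
  define m where "m = (LEAST m::nat. 0 < m \<and> g [^] m \<in> P)"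
  have m: "0 < m \<and> g [^] m \<in> P"
    unfolding m_def using LeastI[of "\<lambda>m::nat. 0 < m \<and> g [^] m \<in> P" n] n gn by blast
  have m_dvd: "m dvd j" if "g [^] j \<in> P" for j :: nat
  proof -
    have "g [^] j = g [^] (m * (j div m)) \<otimes> g [^] (j mod m)"
      using g by (simp add: nat_pow_mult)
    also have "g [^] (m * (j div m)) = (g [^] m) [^] (j div m)"
      using g by (simp add: nat_pow_pow)
    finally have "g [^] (j mod m) \<in> P"
      using that mem_iff_of_mult_mem[of "g [^] (j mod m)" "(g [^] m) [^] (j div m)"]
        pow_mem m g by simp
    moreover have "j mod m < m" using m by simp
    ultimately have "j mod m = 0"
      using not_less_Least[of "j mod m" "\<lambda>m::nat. 0 < m \<and> g [^] m \<in> P"] m_def by auto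
    then show ?thesis by auto
  qed
  have "m = n"
    using proper[of m] m m_dvd[OF gn] n dvd_imp_le by (metis nat_less_le)
  moreover have "g [^] k \<in> P" if "n dvd k"
    using that pow_mem[OF gn] g by (auto simp: nat_pow_pow elim!: dvdE)
  ultimately show ?thesis using m_dvd by blast
qed

text \<open>
  The class of \<open>g\<close> has order exactly \<open>n\<close>; the subgroup is the image of \<open>i \<mapsto> P #> g [^] i\<close>.
\<close>

lemma cyclic_subgroup_Mod:
  assumes g: "g \<in> carrier G" and n: "0 < n" and gn: "g [^] n \<in> P"
    and proper: "\<And>m. 0 < m \<Longrightarrow> m < n \<Longrightarrow> m dvd n \<Longrightarrow> g [^] m \<notin> P"
  shows "\<exists>H. subgroup H (G Mod P) \<and> (G Mod P)\<lparr>carrier := H\<rparr> \<cong> integer_mod_group n"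
proof -
  note dvd = pow_mem_iff_dvd[OF g n gn proper]
  define c where "c = (\<lambda>i::int. P #> g [^] nat i)"
  define H where "H = c ` {0..<int n}"
  have c_mod: "P #> g [^] k = c (int k mod int n)" for k :: nat
  proof -
    have "g [^] k = g [^] (n * (k div n)) \<otimes> g [^] (k mod n)"
      using g by (simp add: nat_pow_mult)
    moreover have "g [^] (n * (k div n)) \<in> P" using dvd by simp
    moreover have "nat (int k mod int n) = k mod n" by (simp add: nat_mod_distrib)
    ultimately show ?thesis unfolding c_def using r_coset_eq_iff g by auto
  qed
  have c_mult: "c i <#> c j = c ((i + j) mod int n)" if "0 \<le> i" "0 \<le> j" for i j
  proof -
    have "c i <#> c j = P #> g [^] (nat i + nat j)"
      using g by (simp add: c_def r_coset_mult nat_pow_mult)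
    then show ?thesis using c_mod[of "nat i + nat j"] that by simp
  qed
  have c_0: "c 0 = P" by (simp add: c_def r_coset_one)
  have inj: "inj_on c {0..<int n}"
  proof -
    have eq: "i = j" if "0 \<le> i" "i \<le> j" "j < int n" "c i = c j" for i j
    proof -
      \<comment> \<open>\<open>g\<close> is invertible up to an element of \<open>P\<close>, so a coincidence can be multiplied by
        \<open>g [^] (n - i)\<close> instead of being cancelled.\<close>
      have "c (int n - i) <#> c i = c (int n - i) <#> c j" using that by simp
      then have "c 0 = c ((int n - i + j) mod int n)"
        using c_mult[of "int n - i" i] c_mult[of "int n - i" j] that by simp
      moreover have "(int n - i + j) mod int n = (j - i) mod int n"
        by (metis add.commute add_diff_eq mod_add_self2)
      moreover have "(j - i) mod int n = j - i" using that by simp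
      ultimately have "P #> g [^] nat (j - i) = P #> \<one>"
        using c_0 by (simp add: c_def r_coset_one)
      then have "g [^] nat (j - i) \<in> P"
        using r_coset_eq_iff g in_carrier by fastforce
      then have "n dvd nat (j - i)" using dvd by simp
      then show "i = j" using that n dvd_imp_le[of n "nat (j - i)"] by fastforce
    qed
    then show ?thesis
      by (intro inj_onI) (metis atLeastLessThan_iff linear)
  qed
  interpret Q: monoid "G Mod P" by (rule monoid_Mod)
  have H_sub: "H \<subseteq> carrier (G Mod P)"
    unfolding H_def c_def carrier_FactGroup using nat_pow_closed[OF g] by blast
  have H_mult: "x <#> y \<in> H" if "x \<in> H" "y \<in> H" for x y
    using that c_mult n by (auto simp: H_def)
  have "subgroup H (G Mod P)"
  proof
    show "\<one>\<^bsub>G Mod P\<^esub> \<in> H" using c_0 n by (force simp: H_def)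
    fix x assume x: "x \<in> H"
    then obtain i where i: "0 \<le> i" "i < int n" "x = c i" by (auto simp: H_def)
    define y where "y = c ((- i) mod int n)"
    have "y \<in> H" using n by (simp add: y_def H_def)
    moreover have "x <#> y = P" "y <#> x = P"
      using i n c_0 by (simp_all add: y_def c_mult mod_add_right_eq mod_add_left_eq)
    ultimately have "inv\<^bsub>G Mod P\<^esub> x = y"
      using x H_sub by (intro Q.inv_char) auto
    then show "inv\<^bsub>G Mod P\<^esub> x \<in> H" using \<open>y \<in> H\<close> by simp
  qed (use H_sub H_mult in auto)
  moreover have "integer_mod_group n \<cong> (G Mod P)\<lparr>carrier := H\<rparr>"
  proof (rule is_isoI, rule isoI)
    show "c \<in> hom (integer_mod_group n) ((G Mod P)\<lparr>carrier := H\<rparr>)"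
      using n c_mult by (auto simp: hom_def carrier_integer_mod_group H_def)
    show "bij_betw c (carrier (integer_mod_group n)) (carrier ((G Mod P)\<lparr>carrier := H\<rparr>))"
      using n inj by (simp add: carrier_integer_mod_group H_def bij_betw_def)
  qed
  ultimately show ?thesis
    using group.iso_sym[OF group_integer_mod_group] by blast
qed

end

section \<open>Power sums with odd exponent\<close>

text \<open>
  These are Dickson polynomials divided by \<open>u\<close>: if \<open>x + y = u\<close> and \<open>x * y = N\<close>, then
  \<open>x ^ (2 * j + 1) + y ^ (2 * j + 1)\<close> is \<open>u\<close> times the value at \<open>N\<close>. Only \<open>N\<close> is the indeterminate, since
  in the application \<open>u\<close> ranges over the divisors of a fixed number. The recursion is that of the power
  sums of \<open>x\<^sup>2\<close> and \<open>y\<^sup>2\<close>, whose sum is \<open>u\<^sup>2 - 2 * N\<close> and whose product is \<open>N\<^sup>2\<close>.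
\<close>

fun odd_power_sum_poly :: "int \<Rightarrow> nat \<Rightarrow> int poly" where
  "odd_power_sum_poly u 0 = 1"
| "odd_power_sum_poly u (Suc 0) = [:u\<^sup>2, - 3:]"
| "odd_power_sum_poly u (Suc (Suc j)) =
     [:u\<^sup>2, - 2:] * odd_power_sum_poly u (Suc j) - [:0, 0, 1:] * odd_power_sum_poly u j"

lemma odd_power_sum:
  fixes x y :: "'a::comm_ring_1"
  assumes u: "x + y = of_int u" and N: "x * y = of_int N"
  shows "x ^ (2 * j + 1) + y ^ (2 * j + 1) = of_int (u * poly (odd_power_sum_poly u j) N)"
  using u
proof (induction u j rule: odd_power_sum_poly.induct)
  case (1 u)
  then show ?case by simp
next
  case (2 u)
  have "x ^ 3 + y ^ 3 = (x + y) * ((x + y)\<^sup>2 - 3 * (x * y))"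
    by (simp add: algebra_simps power2_eq_square power3_eq_cube)
  then show ?case by (simp add: 2 N power3_eq_cube algebra_simps)
next
  case (3 u j)
  have "x ^ (2 * Suc (Suc j) + 1) + y ^ (2 * Suc (Suc j) + 1) =
      ((x + y)\<^sup>2 - 2 * (x * y)) * (x ^ (2 * Suc j + 1) + y ^ (2 * Suc j + 1))
      - (x * y)\<^sup>2 * (x ^ (2 * j + 1) + y ^ (2 * j + 1))"
    by (simp add: algebra_simps power2_eq_square)
  also have "\<dots> = of_int (u * ((u\<^sup>2 - 2 * N) * poly (odd_power_sum_poly u (Suc j)) N
      - N\<^sup>2 * poly (odd_power_sum_poly u j) N))"
    unfolding "3.IH"(1)[OF "3.prems"] "3.IH"(2)[OF "3.prems"] unfolding "3.prems" N
    by (simp only: of_int_mult of_int_diff of_int_power of_int_numeral right_diff_distrib mult.left_commute)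
  also have "(u\<^sup>2 - 2 * N) * poly (odd_power_sum_poly u (Suc j)) N
      - N\<^sup>2 * poly (odd_power_sum_poly u j) N = poly (odd_power_sum_poly u (Suc (Suc j))) N"
    by (simp only: odd_power_sum_poly.simps poly_diff poly_mult poly_pCons poly_0)
      (simp add: power2_eq_square)
  finally show ?case .
qed

text \<open>
  Both terms of the recursion contribute in degree \<open>j\<close>. The contributions obey
  \<open>c (j + 2) = - 2 * c (j + 1) - c j\<close>, so the coefficients alternate in sign with absolute value
  \<open>2 * j + 1\<close> and never vanish. Hence the degree in \<open>N\<close> is exactly \<open>j\<close>.
\<close>

lemma coeff_odd_power_sum_poly:
  "Polynomial.degree (odd_power_sum_poly u j) \<le> j \<and>
   Polynomial.coeff (odd_power_sum_poly u j) j = (- 1) ^ j * (2 * int j + 1)"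
proof (induction u j rule: odd_power_sum_poly.induct)
  case (3 u j)
  have z: "Polynomial.coeff (odd_power_sum_poly u (Suc j)) (Suc (Suc j)) = 0"
    using 3 by (intro coeff_eq_0) auto
  have "Polynomial.degree ([:u\<^sup>2, - 2:] * odd_power_sum_poly u (Suc j)) \<le> 1 + Suc j"
    using 3 by (intro order.trans[OF degree_mult_le] add_mono) auto
  moreover have "Polynomial.degree ([:0, 0, 1:] * odd_power_sum_poly u j) \<le> 2 + j"
    using 3 by (intro order.trans[OF degree_mult_le] add_mono) auto
  ultimately have "Polynomial.degree (odd_power_sum_poly u (Suc (Suc j))) \<le> Suc (Suc j)"
    by (simp only: odd_power_sum_poly.simps) (intro degree_diff_le; simp)
  then show ?case using 3 z by (simp add: algebra_simps)
qed auto

text \<open>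
  The factor \<open>u\<close> divides \<open>a\<close>, which leaves finitely many \<open>u\<close>. For each of them \<open>N\<close> is a root of a
  polynomial of positive degree \<open>j\<close>.
\<close>

lemma finite_odd_power_sum_eq:
  assumes "a \<noteq> 0" and "0 < j"
  shows "finite {N. \<exists>u. u * poly (odd_power_sum_poly u j) N = a}"
proof -
  define q where "q = (\<lambda>u. Polynomial.smult u (odd_power_sum_poly u j) - [:a:])"
  have q_nz: "q u \<noteq> 0" if "u \<noteq> 0" for u
  proof
    assume "q u = 0"
    then have "Polynomial.coeff (q u) j = 0" by simp
    moreover have "Polynomial.coeff (q u) j = u * ((- 1) ^ j * (2 * int j + 1))"
      using assms coeff_odd_power_sum_poly[of u j]
      by (simp add: q_def coeff_pCons split: nat.split)
    ultimately show False using that by auto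
  qed
  have "{N. \<exists>u. u * poly (odd_power_sum_poly u j) N = a}
    \<subseteq> (\<Union>u\<in>{- \<bar>a\<bar>..\<bar>a\<bar>} - {0}. {N. poly (q u) N = 0})"
  proof
    fix N assume "N \<in> {N. \<exists>u. u * poly (odd_power_sum_poly u j) N = a}"
    then obtain u where u: "u * poly (odd_power_sum_poly u j) N = a" by blast
    then have "u dvd a" by (metis dvd_triv_left)
    then have "\<bar>u\<bar> \<le> \<bar>a\<bar>" using dvd_imp_le_int[OF assms(1)] by simp
    moreover have "u \<noteq> 0" using u assms(1) by (metis mult_zero_left)
    ultimately show "N \<in> (\<Union>u\<in>{- \<bar>a\<bar>..\<bar>a\<bar>} - {0}. {N. poly (q u) N = 0})"
      using u by (intro UN_I[of u]) (simp_all add: q_def abs_le_iff)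
  qed
  moreover have "finite (\<Union>u\<in>{- \<bar>a\<bar>..\<bar>a\<bar>} - {0}. {N. poly (q u) N = 0})"
    using q_nz by (intro finite_UN_I poly_roots_finite) auto
  ultimately show ?thesis by (rule finite_subset)
qed

section \<open>Primes congruent to 2 modulo 3\<close>

lemma ex_prime_factor_2_mod_3:
  fixes n :: nat
  assumes "n mod 3 = 2"
  shows "\<exists>p. Factorial_Ring.prime p \<and> p dvd n \<and> p mod 3 = 2"
  using assms
proof (induction n rule: less_induct)
  case (less n)
  have "n \<noteq> 1" using less.prems by auto
  then obtain p where p: "Factorial_Ring.prime p" "p dvd n" using prime_factor_nat by blast
  then obtain k where k: "n = p * k" by blast
  show ?case
  proof (cases "p mod 3 = 2")
    case False
    have "p mod 3 \<noteq> 0" using less.prems k by (metis mod_mult_left_eq mult_0 mod_0 zero_neq_numeral)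
    then have "p mod 3 = 1" using False by linarith
    then have "k mod 3 = 2" using less.prems k by (metis mod_mult_left_eq mult_1)
    moreover have "k < n"
      using k p less.prems prime_gt_1_nat[OF p(1)] by (cases "k = 0") auto
    ultimately obtain q where "Factorial_Ring.prime q" "q dvd k" "q mod 3 = 2"
      using less.IH by blast
    then show ?thesis using k by auto
  qed (use p in blast)
qed

text \<open>
  Euclid's argument: the number \<open>3 * m! - 1\<close> is \<open>2\<close> modulo \<open>3\<close>, so not all its prime factors can be \<open>1\<close>
  modulo \<open>3\<close>, and none of them is at most \<open>m\<close>.
\<close>

lemma infinite_primes_2_mod_3: "infinite {p::nat. Factorial_Ring.prime p \<and> p mod 3 = 2}"
  unfolding infinite_nat_iff_unbounded
proof
  fix m :: nat
  obtain f :: nat where f: "fact m = Suc f"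
    using not0_implies_Suc[OF fact_nonzero] by blast
  have "3 * fact m - 1 = 2 + f * 3" using f by simp
  then have "(3 * fact m - 1) mod 3 = (2::nat)" using mod_mult_self1[of 2 f 3] by simp
  from ex_prime_factor_2_mod_3[OF this]
  obtain p :: nat where p: "Factorial_Ring.prime p" "p dvd 3 * fact m - 1" "p mod 3 = 2" by blast
  have "m < p"
  proof (rule ccontr)
    assume "\<not> m < p"
    then have "p dvd fact m" using prime_dvd_fact_iff[OF p(1)] by simp
    then have "p dvd 3 * fact m - (3 * fact m - 1)"
      using p(2) by (rule dvd_diff_nat[OF dvd_mult])
    also have "3 * fact m - (3 * fact m - 1) = (1::nat)" using f by simp
    finally show False using not_prime_unit p(1) by blast
  qed
  then show "\<exists>n>m. n \<in> {p. Factorial_Ring.prime p \<and> p mod 3 = 2}" using p(1,3) by auto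
qed

section \<open>Imaginary quadratic fields and their integers\<close>

lemma complex_ring_simps [simp]:
  "carrier complex_ring = UNIV"
  "x \<otimes>\<^bsub>complex_ring\<^esub> y = x * y" "x \<oplus>\<^bsub>complex_ring\<^esub> y = x + y"
  "\<one>\<^bsub>complex_ring\<^esub> = 1" "\<zero>\<^bsub>complex_ring\<^esub> = 0"
  by (simp_all add: ring_of_type_algebra_def)

interpretation CR: cring complex_ring
  by (rule cring_from_type_algebra)

lemma complex_ring_uminus [simp]: "\<ominus>\<^bsub>complex_ring\<^esub> x = - x"
  by (rule CR.minus_equality) auto

lemma complex_ring_inverse [simp]: "x \<noteq> 0 \<Longrightarrow> inv\<^bsub>complex_ring\<^esub> x = inverse x"
  by (rule CR.comm_inv_char) auto

lemma complex_additive_subgroup_iff: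
  "additive_subgroup I complex_ring \<longleftrightarrow>
     0 \<in> I \<and> (\<forall>x\<in>I. \<forall>y\<in>I. x + y \<in> I) \<and> (\<forall>x\<in>I. - x \<in> I)"
proof
  assume "additive_subgroup I complex_ring"
  then interpret additive_subgroup I complex_ring .
  show "0 \<in> I \<and> (\<forall>x\<in>I. \<forall>y\<in>I. x + y \<in> I) \<and> (\<forall>x\<in>I. - x \<in> I)"
    using zero_closed a_closed a_inv_closed by auto
next
  assume I: "0 \<in> I \<and> (\<forall>x\<in>I. \<forall>y\<in>I. x + y \<in> I) \<and> (\<forall>x\<in>I. - x \<in> I)"
  show "additive_subgroup I complex_ring"
  proof (rule additive_subgroupI, rule subgroup.intro)
    show "inv\<^bsub>add_monoid complex_ring\<^esub> x \<in> I" if "x \<in> I" for x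
      using I that complex_ring_uminus[of x] by (simp add: a_inv_def)
  qed (use I in auto)
qed

lemma Rats_cnj: "r \<in> \<rat> \<Longrightarrow> cnj r = r"
  by (auto elim!: Rats_cases')

lemma map_poly_of_int_add:
  "map_poly of_int (f + g) = (map_poly of_int f + map_poly of_int g :: complex poly)"
  by (intro poly_eqI) (simp add: coeff_map_poly)

lemma map_poly_of_int_mult:
  "map_poly of_int (f * g) = (map_poly of_int f * map_poly of_int g :: complex poly)"
  by (induction f) (simp_all add: map_poly_pCons map_poly_of_int_add map_poly_smult)

text \<open>
  An irrational \<open>x\<close> with rational trace and norm has a primitive integral quadratic polynomial \<open>q\<close> as
  its minimal polynomial up to scaling. By Gauss's lemma \<open>q\<close> divides every monic integral polynomial that
  vanishes at \<open>x\<close>, so its leading coefficient is a unit.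
\<close>

lemma algebraic_int_imp_Ints_trace_norm:
  fixes x :: complex
  assumes x: "algebraic_int x" "x \<notin> \<rat>"
    and t: "x + cnj x \<in> \<rat>" and N: "x * cnj x \<in> \<rat>"
  shows "x + cnj x \<in> \<int>" and "x * cnj x \<in> \<int>"
proof -
  obtain p where p: "poly (map_poly of_int p) x = 0" "Polynomial.lead_coeff p = 1"
    using x(1) algebraic_int_altdef_ipoly by blast
  obtain b c where bc: "x + cnj x = of_int b / of_int c" "c \<noteq> 0"
    using t by (elim Rats_cases') auto
  obtain d e where de: "x * cnj x = of_int d / of_int e" "e \<noteq> 0"
    using N by (elim Rats_cases') auto
  define q0 where "q0 = [:d * c, - (b * e), c * e:]"
  define q where "q = primitive_part q0"
  have q0_q: "q0 = Polynomial.smult (content q0) q" by (simp add: q_def)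
  have q0_nz: "q0 \<noteq> 0" using bc de by (simp add: q0_def)
  have q_nz: "q \<noteq> 0" and content_q: "content q = 1"
    using q0_nz by (simp_all add: q_def)
  have deg_q: "Polynomial.degree q = 2"
    using arg_cong[OF q0_q, of Polynomial.degree] q0_nz bc de by (simp add: q0_def)
  have root_q0: "poly (map_poly of_int q0) x = 0"
  proof -
    have "poly (map_poly of_int q0) x =
        of_int (c * e) * (x\<^sup>2 - (of_int b / of_int c) * x + of_int d / of_int e)"
      using bc(2) de(2) by (simp add: q0_def map_poly_pCons field_simps power2_eq_square)
    also have "\<dots> = 0"
      unfolding bc(1)[symmetric] de(1)[symmetric] by (simp add: algebra_simps power2_eq_square)
    finally show ?thesis .
  qed
  have root_q: "poly (map_poly of_int q) x = 0"
  proof -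
    have "map_poly complex_of_int q0 = Polynomial.smult (of_int (content q0)) (map_poly of_int q)"
      by (subst q0_q) (simp add: map_poly_smult)
    then show ?thesis using root_q0 q0_nz by simp
  qed
  \<comment> \<open>Dividing \<open>p\<close> by \<open>q\<close> up to an integer factor leaves a remainder of degree at most \<open>1\<close>, which
    vanishes because its root \<open>x\<close> is irrational.\<close>
  obtain a s r where a: "a \<noteq> 0" and as: "Polynomial.smult a p = q * s + r"
    and r: "r = 0 \<or> Polynomial.degree r < Polynomial.degree q"
    using pseudo_mod[OF q_nz, of p] by blast
  have root_r: "poly (map_poly of_int r) x = 0"
    using arg_cong[OF as, of "\<lambda>f. poly (map_poly of_int f) x"] p(1) root_q 
    by (simp add: map_poly_of_int_add map_poly_of_int_mult map_poly_smult)
  have "r = 0"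
  proof (rule ccontr)
    assume "r \<noteq> 0"
    then have "Polynomial.degree r \<le> 1" using r deg_q by auto
    then have "r = [:Polynomial.coeff r 0, Polynomial.coeff r 1:]"
      by (intro poly_eqI) (auto simp: coeff_pCons coeff_eq_0 split: nat.split)
    then obtain u v where r_eq: "r = [:v, u:]" by blast
    have lin: "of_int v + of_int u * x = 0"
      using root_r by (simp add: r_eq map_poly_pCons mult.commute)
    show False
    proof (cases "u = 0")
      case True
      then show False using lin r_eq \<open>r \<noteq> 0\<close> by simp
    next
      case False
      then have "x = (of_int u * x) / of_int u" by simp
      also have "of_int u * x = - of_int v" using lin by (simp add: add_eq_0_iff2 add.commute)
      finally have "x \<in> \<rat>" by simp
      then show False using x(2) by simp
    qed
  qed
  have p_monic: "content p = 1"
    using content_dvd_coeff[of p "Polynomial.degree p"] p(2)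
    by (metis is_unit_content_iff)
  \<comment> \<open>Gauss's lemma: \<open>q\<close> is primitive, so it divides \<open>p\<close> over the integers.\<close>
  have "content s = \<bar>a\<bar>"
    using arg_cong[OF as, of content] \<open>r = 0\<close> content_q p_monic by (simp add: content_mult)
  then obtain s' where "s = Polynomial.smult \<bar>a\<bar> s'"
    by (metis content_times_primitive_part)
  then have "Polynomial.smult a p = Polynomial.smult a (q * Polynomial.smult (sgn a) s')"
    using as \<open>r = 0\<close> by (simp add: abs_sgn mult.commute)
  then have "p = q * Polynomial.smult (sgn a) s'"
    using a by (metis smult_cancel)
  then have "Polynomial.lead_coeff q dvd 1"
    using p(2) by (metis dvd_triv_left lead_coeff_mult)
  define k where "k = content q0"
  have coeffs: "c * e = k * Polynomial.coeff q 2" "- (b * e) = k * Polynomial.coeff q 1"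
      "d * c = k * Polynomial.coeff q 0"
    using arg_cong[OF q0_q, of "\<lambda>f. Polynomial.coeff f 2"]
      arg_cong[OF q0_q, of "\<lambda>f. Polynomial.coeff f 1"]
      arg_cong[OF q0_q, of "\<lambda>f. Polynomial.coeff f 0"]
    by (simp_all add: q0_def k_def numeral_2_eq_2)
  obtain w where w: "w * Polynomial.coeff q 2 = 1"
    using \<open>Polynomial.lead_coeff q dvd 1\<close> deg_q by (auto simp: dvd_def mult.commute)
  have k: "k = c * e * w" using coeffs(1) w by (simp add: mult.assoc mult.commute)
  have "e * b = e * (c * (- w * Polynomial.coeff q 1))"
  proof -
    have "e * b = - (k * Polynomial.coeff q 1)"
      using coeffs(2) by (metis minus_minus mult.commute)
    then show ?thesis unfolding k by (simp only: mult_minus_left mult_minus_right ac_simps)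
  qed
  then have "b = c * (- w * Polynomial.coeff q 1)" using mult_left_cancel[OF de(2)] by blast
  then show "x + cnj x \<in> \<int>"
    using bc by simp
  have "c * d = c * (e * (w * Polynomial.coeff q 0))"
    using coeffs(3) unfolding k by (simp only: ac_simps)
  then have "d = e * (w * Polynomial.coeff q 0)" using mult_left_cancel[OF bc(2)] by blast
  then show "x * cnj x \<in> \<int>"
    using de by simp
qed

lemma algebraic_int_if_Ints_trace_norm:
  fixes x :: complex
  assumes t: "x + cnj x \<in> \<int>" and N: "x * cnj x \<in> \<int>"
  shows "algebraic_int x"
proof (rule algebraic_int.intros)
  let ?p = "[:x * cnj x, - (x + cnj x), 1:]"
  show "Polynomial.lead_coeff ?p = 1" by simp
  show "\<forall>i. Polynomial.coeff ?p i \<in> \<int>"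
    using Ints_minus[OF t] N by (auto simp: coeff_pCons split: nat.splits)
  show "poly ?p x = 0" by (simp add: algebra_simps)
qed

lemma rational_monic_quadratic_root_Ints:
  fixes x :: complex
  assumes "x \<in> \<rat>" "b \<in> \<int>" "c \<in> \<int>" "x\<^sup>2 - b * x + c = 0"
  shows "x \<in> \<int>"
proof (rule rational_algebraic_int_is_int)
  show "algebraic_int x"
  proof (rule algebraic_int.intros)
    let ?p = "[:c, - b, 1:]"
    show "Polynomial.lead_coeff ?p = 1" by simp
    show "\<forall>i. Polynomial.coeff ?p i \<in> \<int>"
      using assms by (auto simp: coeff_pCons split: nat.splits)
    show "poly ?p x = 0" using assms(4) by (simp add: algebra_simps power2_eq_square)
  qed
qed (use assms in auto)

locale imaginary_quadratic_field =
  fixes D :: int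
  assumes D_neg: "D < 0"
begin

definition sqrtD :: complex where "sqrtD = csqrt (of_int D)"

abbreviation K :: "complex set" where "K \<equiv> rat_adjoin_sqrt D"
abbreviation OK :: "complex set" where "OK \<equiv> ring_of_integers K"

lemma sqrtD_squared: "sqrtD\<^sup>2 = of_int D"
  by (simp add: sqrtD_def)

lemma cnj_sqrtD: "cnj sqrtD = - sqrtD" and Im_sqrtD_pos: "Im sqrtD > 0"
proof -
  have "csqrt (of_real (of_int D)) = \<i> * of_real (sqrt \<bar>of_int D\<bar>)"
    using D_neg by (subst csqrt_of_real_nonpos) auto
  then have "sqrtD = \<i> * of_real (sqrt \<bar>of_int D\<bar>)"
    by (simp add: sqrtD_def)
  then show "cnj sqrtD = - sqrtD" "Im sqrtD > 0"
    using D_neg by simp_all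
qed

lemma K_add: "x \<in> K \<Longrightarrow> y \<in> K \<Longrightarrow> x + y \<in> K"
  using generate_field.eng_add[of x complex_ring _ y] by (simp add: rat_adjoin_sqrt_def)

lemma K_mult: "x \<in> K \<Longrightarrow> y \<in> K \<Longrightarrow> x * y \<in> K"
  using generate_field.eng_mult[of x complex_ring _ y] by (simp add: rat_adjoin_sqrt_def)

lemma K_uminus: "x \<in> K \<Longrightarrow> - x \<in> K"
  using generate_field.a_inv[of x complex_ring] by (simp add: rat_adjoin_sqrt_def)

lemma K_inverse: "x \<in> K \<Longrightarrow> inverse x \<in> K"
  using generate_field.m_inv[of x complex_ring]
  by (cases "x = 0") (simp_all add: rat_adjoin_sqrt_def)

lemma K_1: "1 \<in> K"
  using generate_field.one[of complex_ring] by (simp add: rat_adjoin_sqrt_def)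

lemma sqrtD_in_K: "sqrtD \<in> K"
  by (simp add: rat_adjoin_sqrt_def sqrtD_def generate_field.incl)

lemma K_diff: "x \<in> K \<Longrightarrow> y \<in> K \<Longrightarrow> x - y \<in> K"
  using K_add[of x "- y"] K_uminus by simp

lemma K_0: "0 \<in> K"
  using K_diff[OF K_1 K_1] by simp

lemma K_of_nat: "of_nat k \<in> K"
  by (induction k) (auto intro: K_0 K_1 K_add)

lemma K_of_int: "of_int k \<in> K"
  using K_of_nat K_uminus by (cases k rule: int_cases2) auto

lemma K_divide: "x \<in> K \<Longrightarrow> y \<in> K \<Longrightarrow> x / y \<in> K"
  using K_mult[of x "inverse y"] K_inverse by (simp add: field_simps)

lemma K_eq: "K = {r + s * sqrtD | r s. r \<in> \<rat> \<and> s \<in> \<rat>}"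
proof
  have Rats_in_K: "r \<in> K" if "r \<in> \<rat>" for r
  proof -
    from that obtain a b where "r = of_int a / of_int b" by (elim Rats_cases')
    then show ?thesis by (simp add: K_divide K_of_int)
  qed
  show "{r + s * sqrtD | r s. r \<in> \<rat> \<and> s \<in> \<rat>} \<subseteq> K"
  proof clarify
    fix r s :: complex assume "r \<in> \<rat>" "s \<in> \<rat>"
    then show "r + s * sqrtD \<in> K" by (intro K_add K_mult sqrtD_in_K Rats_in_K)
  qed
  show "K \<subseteq> {r + s * sqrtD | r s. r \<in> \<rat> \<and> s \<in> \<rat>}" (is "_ \<subseteq> ?Q")
  proof
    have QI: "x \<in> ?Q" if "x = r + s * sqrtD" "r \<in> \<rat>" "s \<in> \<rat>" for x r s
      using that by blast
    fix x assume "x \<in> K"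
    then show "x \<in> ?Q"
      unfolding rat_adjoin_sqrt_def
    proof induction
      case one
      show ?case by (rule QI[of _ 1 0]) auto
    next
      case (incl h)
      show ?case by (rule QI[of _ 0 1]) (use incl in \<open>auto simp: sqrtD_def\<close>)
    next
      case (a_inv h)
      then obtain r s where h: "h = r + s * sqrtD" "r \<in> \<rat>" "s \<in> \<rat>" by blast
      show ?case by (rule QI[of _ "- r" "- s"]) (use h in auto)
    next
      case (m_inv h)
      then obtain r s where h: "h = r + s * sqrtD" "r \<in> \<rat>" "s \<in> \<rat>" by blast
      define d where "d = r\<^sup>2 - s\<^sup>2 * of_int D"
      have h_d: "h * (r - s * sqrtD) = d"
        unfolding h d_def sqrtD_squared[symmetric] by (simp add: algebra_simps power2_eq_square)
      have "r - s * sqrtD = cnj h"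
        using h cnj_sqrtD by (simp add: Rats_cnj)
      then have "d = h * cnj h" using h_d by simp
      then have d_nz: "d \<noteq> 0" using m_inv.hyps(2) by simp
      have "inverse h * d = r - s * sqrtD"
        unfolding h_d[symmetric] using m_inv.hyps(2) by (simp flip: mult.assoc)
      then have "inverse h = (r - s * sqrtD) / d"
        using d_nz by (simp add: eq_divide_eq)
      then have "inv\<^bsub>complex_ring\<^esub> h = r / d + (- s / d) * sqrtD"
        using m_inv.hyps(2) by (simp add: diff_divide_distrib)
      moreover have "d \<in> \<rat>" using h by (simp add: d_def)
      ultimately show ?case using h by (intro QI[of _ "r / d" "- s / d"]) auto
    next
      case (eng_add h1 h2)
      then obtain r1 s1 r2 s2 where h: "h1 = r1 + s1 * sqrtD" "h2 = r2 + s2 * sqrtD"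
        "r1 \<in> \<rat>" "s1 \<in> \<rat>" "r2 \<in> \<rat>" "s2 \<in> \<rat>" by blast
      show ?case by (rule QI[of _ "r1 + r2" "s1 + s2"]) (use h in \<open>auto simp: algebra_simps\<close>)
    next
      case (eng_mult h1 h2)
      then obtain r1 s1 r2 s2 where h: "h1 = r1 + s1 * sqrtD" "h2 = r2 + s2 * sqrtD"
        "r1 \<in> \<rat>" "s1 \<in> \<rat>" "r2 \<in> \<rat>" "s2 \<in> \<rat>" by blast
      have "h1 * h2 = (r1 * r2 + s1 * s2 * of_int D) + (r1 * s2 + s1 * r2) * sqrtD"
        unfolding h sqrtD_squared[symmetric] by (simp add: algebra_simps power2_eq_square)
      then show ?case
        using h by (intro QI[of _ "r1 * r2 + s1 * s2 * of_int D" "r1 * s2 + s1 * r2"]) auto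
    qed
  qed
qed

lemma K_cases:
  assumes "x \<in> K"
  obtains r s :: real where "x = of_real r + of_real s * sqrtD" "r \<in> \<rat>" "s \<in> \<rat>"
proof -
  obtain r s where "x = r + s * sqrtD" "r \<in> \<rat>" "s \<in> \<rat>" using assms K_eq by blast
  then show ?thesis
    using that[of "Re r" "Re s"] by (auto elim!: Rats_cases')
qed

lemma K_cnj: "x \<in> K \<Longrightarrow> cnj x \<in> K"
proof -
  assume "x \<in> K"
  then obtain r s where x: "x = of_real r + of_real s * sqrtD" "r \<in> \<rat>" "s \<in> \<rat>"
    by (rule K_cases)
  have "cnj x = of_real r + of_real (- s) * sqrtD" by (simp add: x cnj_sqrtD)
  moreover have "complex_of_real r \<in> \<rat>" "complex_of_real (- s) \<in> \<rat>" using x by simp_all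
  ultimately show "cnj x \<in> K" unfolding K_eq by blast
qed

lemma real_in_K:
  assumes "x \<in> K" "cnj x = x"
  shows "x \<in> \<rat>"
proof -
  obtain r s where x: "x = of_real r + of_real s * sqrtD" "r \<in> \<rat>" "s \<in> \<rat>"
    using assms(1) by (rule K_cases)
  have "s * Im sqrtD = Im x" by (simp add: x)
  also have "\<dots> = 0" using assms(2) by (simp add: complex_eq_iff)
  finally have "x = of_real r" using Im_sqrtD_pos x by simp
  then show ?thesis using x(2) by simp
qed

lemma trace_in_Rats: "x \<in> K \<Longrightarrow> x + cnj x \<in> \<rat>"
  and norm_in_Rats: "x \<in> K \<Longrightarrow> x * cnj x \<in> \<rat>"
  by (rule real_in_K; simp add: K_add K_mult K_cnj ac_simps)+

text \<open>
  Algebraic integers are defined by the existence of some monic polynomial, which says nothing about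
  sums and products; trace and norm give a criterion that can be computed with.
\<close>

lemma mem_OK_iff: "x \<in> OK \<longleftrightarrow> x \<in> K \<and> x + cnj x \<in> \<int> \<and> x * cnj x \<in> \<int>"
proof
  assume x: "x \<in> OK"
  then have x': "x \<in> K" "algebraic_int x" by (auto simp: ring_of_integers_def)
  show "x \<in> K \<and> x + cnj x \<in> \<int> \<and> x * cnj x \<in> \<int>"
  proof (cases "x \<in> \<rat>")
    case True
    then have "x \<in> \<int>" using x' rational_algebraic_int_is_int by blast
    then show ?thesis using x' by (auto elim!: Ints_cases)
  next
    case False
    then show ?thesis
      using x' algebraic_int_imp_Ints_trace_norm trace_in_Rats norm_in_Rats by blast
  qed
qed (auto simp: ring_of_integers_def intro: algebraic_int_if_Ints_trace_norm)

lemma OK_cnj: "x \<in> OK \<Longrightarrow> cnj x \<in> OK"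
  unfolding mem_OK_iff using K_cnj[of x] by (simp add: ac_simps)

lemma OK_subset_K: "OK \<subseteq> K"
  by (auto simp: ring_of_integers_def)

text \<open>
  This is the step that makes the integers of \<open>K\<close> a ring. The two mixed traces are rational, and their
  sum and their product are polynomials in the traces and norms of \<open>x\<close> and \<open>y\<close>. So they are rational roots
  of a monic integral quadratic polynomial.
\<close>

lemma mixed_traces_Ints:
  assumes x: "x \<in> OK" and y: "y \<in> OK"
  shows "x * cnj y + cnj x * y \<in> \<int>" and "x * y + cnj x * cnj y \<in> \<int>"
proof -
  let ?T = "x * cnj y + cnj x * y" and ?T' = "x * y + cnj x * cnj y"
  let ?tx = "x + cnj x" and ?nx = "x * cnj x" and ?ty = "y + cnj y" and ?ny = "y * cnj y"
  note ints = x[unfolded mem_OK_iff] y[unfolded mem_OK_iff]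
  have K: "x \<in> K" "y \<in> K" "cnj x \<in> K" "cnj y \<in> K"
    using ints K_cnj by auto
  have sum: "?T + ?T' = ?tx * ?ty" by (simp add: algebra_simps)
  have prod: "?T * ?T' = ?ny * (?tx\<^sup>2 - 2 * ?nx) + ?nx * (?ty\<^sup>2 - 2 * ?ny)"
    by (simp add: algebra_simps power2_eq_square)
  have int: "?T + ?T' \<in> \<int>" "?T * ?T' \<in> \<int>"
    unfolding sum prod using ints by auto
  have "?T\<^sup>2 - (?T + ?T') * ?T + ?T * ?T' = 0"
    by (simp add: algebra_simps power2_eq_square)
  moreover have "?T \<in> \<rat>"
    using K by (intro real_in_K K_add K_mult) auto
  ultimately show T: "?T \<in> \<int>"
    using rational_monic_quadratic_root_Ints int by blast
  show "?T' \<in> \<int>" using Ints_diff[OF int(1) T] by simp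
qed

lemma OK_add: "x \<in> OK \<Longrightarrow> y \<in> OK \<Longrightarrow> x + y \<in> OK"
proof -
  assume xy: "x \<in> OK" "y \<in> OK"
  have "(x + y) + cnj (x + y) = (x + cnj x) + (y + cnj y)" by simp
  then have "(x + y) + cnj (x + y) \<in> \<int>"
    using xy unfolding mem_OK_iff by (metis Ints_add)
  moreover have "(x + y) * cnj (x + y) = x * cnj x + y * cnj y + (x * cnj y + cnj x * y)"
    by (simp add: algebra_simps)
  then have "(x + y) * cnj (x + y) \<in> \<int>"
    using xy mixed_traces_Ints(1)[OF xy] unfolding mem_OK_iff by (metis Ints_add)
  ultimately show ?thesis
    using xy K_add unfolding mem_OK_iff by blast
qed

lemma OK_mult: "x \<in> OK \<Longrightarrow> y \<in> OK \<Longrightarrow> x * y \<in> OK"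
proof -
  assume xy: "x \<in> OK" "y \<in> OK"
  have "(x * y) + cnj (x * y) = x * y + cnj x * cnj y" by simp
  moreover have "(x * y) * cnj (x * y) = (x * cnj x) * (y * cnj y)" by simp
  ultimately show ?thesis
    using xy mixed_traces_Ints[OF xy] unfolding mem_OK_iff
    by (metis K_mult Ints_mult)
qed

lemma OK_of_int: "of_int k \<in> OK"
  by (auto simp: mem_OK_iff K_of_int)

lemma OK_0: "0 \<in> OK" and OK_1: "1 \<in> OK"
  using OK_of_int[of 0] OK_of_int[of 1] by simp_all

lemma OK_power: "x \<in> OK \<Longrightarrow> x ^ k \<in> OK"
  by (induction k) (auto intro: OK_1 OK_mult)

lemma sqrtD_in_OK: "sqrtD \<in> OK"
proof -
  have "sqrtD * cnj sqrtD = of_int (- D)"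
    using sqrtD_squared by (simp add: cnj_sqrtD power2_eq_square)
  then show ?thesis unfolding mem_OK_iff by (simp add: sqrtD_in_K cnj_sqrtD)
qed

lemma ex_denominator:
  assumes "x \<in> K"
  shows "\<exists>d\<in>OK - {0}. d * x \<in> OK"
proof -
  obtain r s where x: "x = r + s * sqrtD" "r \<in> \<rat>" "s \<in> \<rat>" using assms K_eq by blast
  obtain a b where r: "r = of_int a / of_int b" "b \<noteq> 0" using x(2) by (elim Rats_cases') auto
  obtain c d where s: "s = of_int c / of_int d" "d \<noteq> 0" using x(3) by (elim Rats_cases') auto
  have "r * of_int b = of_int a" "s * of_int d = of_int c" using r s by simp_all
  moreover have "of_int (b * d) * x = (r * of_int b) * of_int d + (s * of_int d) * of_int b * sqrtD"
    by (simp add: x algebra_simps)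
  ultimately have "of_int (b * d) * x = of_int (a * d) + of_int (c * b) * sqrtD" by simp
  also have "\<dots> \<in> OK" by (intro OK_add OK_mult OK_of_int sqrtD_in_OK)
  finally show ?thesis
    using r s OK_of_int[of "b * d"] by (intro bexI[of _ "of_int (b * d)"]) auto
qed

end

section \<open>Fractional ideals of an imaginary quadratic field\<close>

lemma ideal_prod_mult_mem: "x \<in> I \<Longrightarrow> y \<in> J \<Longrightarrow> x * y \<in> ideal_prod complex_ring I J"
  using ideal_prod.prod[of x I y J complex_ring] by simp

lemma ideal_prod_add_mem:
  "x \<in> ideal_prod complex_ring I J \<Longrightarrow> y \<in> ideal_prod complex_ring I J \<Longrightarrow>
   x + y \<in> ideal_prod complex_ring I J"
  using ideal_prod.sum[of x complex_ring I J y] by simp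

lemma ideal_prod_least:
  assumes "\<And>x y. x \<in> I \<Longrightarrow> y \<in> J \<Longrightarrow> x * y \<in> L" and "\<And>x y. x \<in> L \<Longrightarrow> y \<in> L \<Longrightarrow> x + y \<in> L"
  shows "ideal_prod complex_ring I J \<subseteq> L"
proof
  fix x assume "x \<in> ideal_prod complex_ring I J"
  then show "x \<in> L" by induction (use assms in auto)
qed

lemma ideal_prod_comm: "ideal_prod complex_ring I J = ideal_prod complex_ring J I"
proof -
  have "ideal_prod complex_ring I J \<subseteq> ideal_prod complex_ring J I" for I J
  proof (rule ideal_prod_least)
    show "x * y \<in> ideal_prod complex_ring J I" if "x \<in> I" "y \<in> J" for x y
      using ideal_prod_mult_mem[OF that(2,1)] by (simp add: mult.commute)
  qed (rule ideal_prod_add_mem)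
  then show ?thesis by blast
qed

lemma ideal_prod_assoc:
  "ideal_prod complex_ring (ideal_prod complex_ring I J) L =
   ideal_prod complex_ring I (ideal_prod complex_ring J L)"
proof -
  have sub: "ideal_prod complex_ring (ideal_prod complex_ring I J) L \<subseteq>
    ideal_prod complex_ring I (ideal_prod complex_ring J L)" (is "_ \<subseteq> ?R") for I J L
  proof (rule ideal_prod_least)
    fix x l assume "x \<in> ideal_prod complex_ring I J" and l: "l \<in> L"
    then show "x * l \<in> ?R"
    proof induction
      case (prod i j)
      then show ?case
        using ideal_prod_mult_mem[OF _ ideal_prod_mult_mem, of i I j J l L]
        by (simp add: mult.assoc)
    next
      case (sum x y)
      then show ?case using ideal_prod_add_mem by (simp add: distrib_right)
    qed
  qed (rule ideal_prod_add_mem)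
  show ?thesis
    using sub[of I J L] sub[of L J I] by (simp add: ideal_prod_comm subset_antisym)
qed

context imaginary_quadratic_field
begin

lemma fractional_ideal_iff:
  "fractional_ideal K I \<longleftrightarrow>
     I \<subseteq> K \<and> I \<noteq> {0} \<and> 0 \<in> I \<and> (\<forall>x\<in>I. \<forall>y\<in>I. x + y \<in> I) \<and> (\<forall>r\<in>OK. \<forall>x\<in>I. r * x \<in> I) \<and>
     (\<exists>d\<in>OK - {0}. \<forall>x\<in>I. d * x \<in> OK)"
proof -
  have "\<forall>x\<in>I. - x \<in> I" if "\<forall>r\<in>OK. \<forall>x\<in>I. r * x \<in> I"
    using that OK_of_int[of "- 1"] by force
  then show ?thesis
    unfolding fractional_ideal_def complex_additive_subgroup_iff by blast
qed

lemma fractional_ideal_prod: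
  assumes I: "fractional_ideal K I" and J: "fractional_ideal K J"
  shows "fractional_ideal K (ideal_prod complex_ring I J)" (is "fractional_ideal K ?P")
proof -
  note I' = I[unfolded fractional_ideal_iff] and J' = J[unfolded fractional_ideal_iff]
  obtain x y where xy: "x \<in> I" "y \<in> J" "x \<noteq> 0" "y \<noteq> 0" using I' J' by blast
  have "x * y \<in> ?P" "x * y \<noteq> 0" using xy ideal_prod_mult_mem by auto
  then have ne: "?P \<noteq> {0}" by blast
  have zero: "0 \<in> ?P" using ideal_prod_mult_mem[of 0 I 0 J] I' J' by simp
  have sub: "?P \<subseteq> K"
    using I' J' by (intro ideal_prod_least K_mult K_add) auto
  have smult: "r * z \<in> ?P" if r: "r \<in> OK" and z: "z \<in> ?P" for r z
    using z
  proof induction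
    case (prod i j)
    then show ?case
      using ideal_prod_mult_mem[of "r * i" I j J] I' r by (simp add: mult.assoc)
  qed (simp add: distrib_left ideal_prod_add_mem)
  obtain d e where d: "d \<in> OK - {0}" "\<forall>x\<in>I. d * x \<in> OK" and e: "e \<in> OK - {0}" "\<forall>x\<in>J. e * x \<in> OK"
    using I' J' by blast
  have den: "(d * e) * z \<in> OK" if "z \<in> ?P" for z
    using that
  proof induction
    case (prod i j)
    have eq: "(d * e) * (i * j) = (d * i) * (e * j)" by (simp add: mult_ac)
    show ?case unfolding complex_ring_simps eq using d e prod by (intro OK_mult[of "d * i" "e * j"]) auto
  qed (simp add: distrib_left OK_add)
  have "d * e \<in> OK - {0}" using d e OK_mult by auto
  then show ?thesis
    unfolding fractional_ideal_iff
    using ne zero sub smult den ideal_prod_add_mem by blast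
qed

lemma fractional_ideal_OK: "fractional_ideal K OK"
  unfolding fractional_ideal_iff
  using OK_subset_K OK_0 OK_1 OK_add OK_mult by (auto intro!: bexI[of _ 1])

lemma OK_ideal_prod:
  assumes "fractional_ideal K I"
  shows "ideal_prod complex_ring OK I = I"
proof
  note I' = assms[unfolded fractional_ideal_iff]
  show "ideal_prod complex_ring OK I \<subseteq> I" using I' by (intro ideal_prod_least) auto
  show "I \<subseteq> ideal_prod complex_ring OK I" using ideal_prod_mult_mem[OF OK_1] by force
qed

sublocale ideals: comm_monoid "fractional_ideal_group K"
proof (rule comm_monoidI)
  show "I \<otimes>\<^bsub>fractional_ideal_group K\<^esub> J = J \<otimes>\<^bsub>fractional_ideal_group K\<^esub> I" for I J
    by (simp add: fractional_ideal_group_def) (rule ideal_prod_comm)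
qed (auto simp: fractional_ideal_group_def fractional_ideal_OK fractional_ideal_prod OK_ideal_prod
      ideal_prod_assoc)

lemma fractional_ideal_principal:
  assumes "x \<in> K - {0}"
  shows "fractional_ideal K (principal_fractional_ideal K x)"
proof -
  obtain d where d: "d \<in> OK - {0}" "d * x \<in> OK" using ex_denominator assms by blast
  have "\<forall>y\<in>principal_fractional_ideal K x. d * y \<in> OK"
    using d OK_mult by (auto simp: principal_fractional_ideal_def simp flip: mult.assoc)
  moreover have "x \<in> principal_fractional_ideal K x" "0 \<in> principal_fractional_ideal K x"
    using OK_1 OK_0 by (force simp: principal_fractional_ideal_def)+
  moreover have "principal_fractional_ideal K x \<subseteq> K"
    using assms OK_subset_K K_mult by (auto simp: principal_fractional_ideal_def)
  moreover have "\<forall>y\<in>principal_fractional_ideal K x. \<forall>z\<in>principal_fractional_ideal K x.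
      y + z \<in> principal_fractional_ideal K x"
    using OK_add by (auto simp: principal_fractional_ideal_def simp flip: distrib_left)
  moreover have "\<forall>r\<in>OK. \<forall>y\<in>principal_fractional_ideal K x. r * y \<in> principal_fractional_ideal K x"
    using OK_mult by (auto simp: principal_fractional_ideal_def mult.left_commute)
  ultimately show ?thesis
    unfolding fractional_ideal_iff using d assms by blast
qed

lemma principal_ideal_prod:
  "ideal_prod complex_ring (principal_fractional_ideal K x) (principal_fractional_ideal K y) =
   principal_fractional_ideal K (x * y)"
proof
  show "ideal_prod complex_ring (principal_fractional_ideal K x) (principal_fractional_ideal K y)
    \<subseteq> principal_fractional_ideal K (x * y)"
  proof (rule ideal_prod_least)
    fix u v assume "u \<in> principal_fractional_ideal K x" "v \<in> principal_fractional_ideal K y"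
    then obtain r s where "r \<in> OK" "s \<in> OK" "u * v = (x * y) * (r * s)"
      by (auto simp: principal_fractional_ideal_def)
    then show "u * v \<in> principal_fractional_ideal K (x * y)"
      using OK_mult unfolding principal_fractional_ideal_def by blast
  qed (use OK_add in \<open>auto simp: principal_fractional_ideal_def simp flip: distrib_left\<close>)
  show "principal_fractional_ideal K (x * y) \<subseteq>
    ideal_prod complex_ring (principal_fractional_ideal K x) (principal_fractional_ideal K y)"
  proof
    fix u assume "u \<in> principal_fractional_ideal K (x * y)"
    then obtain r where r: "r \<in> OK" "u = (x * r) * (y * 1)"
      by (auto simp: principal_fractional_ideal_def)
    show "u \<in> ideal_prod complex_ring (principal_fractional_ideal K x) (principal_fractional_ideal K y)"
      unfolding r(2) using r(1) OK_1
      by (intro ideal_prod_mult_mem) (auto simp: principal_fractional_ideal_def)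
  qed
qed

lemma principal_1: "principal_fractional_ideal K 1 = OK"
  by (simp add: principal_fractional_ideal_def)

lemma principal_pow:
  "principal_fractional_ideal K x [^]\<^bsub>fractional_ideal_group K\<^esub> (k::nat) =
   principal_fractional_ideal K (x ^ k)"
proof (induction k)
  case 0
  show ?case by (simp add: principal_1) (simp add: fractional_ideal_group_def)
next
  case (Suc k)
  then show ?case
    by simp (simp add: fractional_ideal_group_def principal_ideal_prod mult.commute)
qed

sublocale principals: unit_subgroup "fractional_ideal_group K"
    "{principal_fractional_ideal K x | x. x \<in> K - {0}}"
proof unfold_locales
  show "{principal_fractional_ideal K x | x. x \<in> K - {0}} \<subseteq> carrier (fractional_ideal_group K)"
    using fractional_ideal_principal by (auto simp: fractional_ideal_group_def)
  show "\<one>\<^bsub>fractional_ideal_group K\<^esub> \<in> {principal_fractional_ideal K x | x. x \<in> K - {0}}"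
    using K_1 principal_1 by (force simp: fractional_ideal_group_def)
next
  fix I J
  assume "I \<in> {principal_fractional_ideal K x | x. x \<in> K - {0}}"
    "J \<in> {principal_fractional_ideal K x | x. x \<in> K - {0}}"
  then obtain x y where xy: "x \<in> K - {0}" "y \<in> K - {0}"
    "I = principal_fractional_ideal K x" "J = principal_fractional_ideal K y" by blast
  then have "I \<otimes>\<^bsub>fractional_ideal_group K\<^esub> J = principal_fractional_ideal K (x * y)"
    by (simp add: fractional_ideal_group_def principal_ideal_prod)
  moreover have "x * y \<in> K - {0}" using xy K_mult by auto
  ultimately show "I \<otimes>\<^bsub>fractional_ideal_group K\<^esub> J \<in> {principal_fractional_ideal K x | x. x \<in> K - {0}}"
    by blast
next
  fix I
  assume "I \<in> {principal_fractional_ideal K x | x. x \<in> K - {0}}"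
  then obtain x where x: "x \<in> K - {0}" "I = principal_fractional_ideal K x" by blast
  have "I \<otimes>\<^bsub>fractional_ideal_group K\<^esub> principal_fractional_ideal K (inverse x) =
      \<one>\<^bsub>fractional_ideal_group K\<^esub>"
    using x by (simp add: fractional_ideal_group_def principal_ideal_prod principal_1)
  moreover have "inverse x \<in> K - {0}" using x K_inverse by auto
  ultimately show "\<exists>J\<in>{principal_fractional_ideal K x | x. x \<in> K - {0}}.
      I \<otimes>\<^bsub>fractional_ideal_group K\<^esub> J = \<one>\<^bsub>fractional_ideal_group K\<^esub>"
    by blast
qed

definition pair_ideal :: "complex \<Rightarrow> complex \<Rightarrow> complex set" where
  "pair_ideal x y = {x * r + y * s | r s. r \<in> OK \<and> s \<in> OK}"

lemma pair_idealI: "r \<in> OK \<Longrightarrow> s \<in> OK \<Longrightarrow> z = x * r + y * s \<Longrightarrow> z \<in> pair_ideal x y"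
  by (auto simp: pair_ideal_def)

lemma pair_ideal_add: "u \<in> pair_ideal x y \<Longrightarrow> v \<in> pair_ideal x y \<Longrightarrow> u + v \<in> pair_ideal x y"
proof -
  assume "u \<in> pair_ideal x y" "v \<in> pair_ideal x y"
  then obtain r s r' s' where h: "r \<in> OK" "s \<in> OK" "r' \<in> OK" "s' \<in> OK"
    "u = x * r + y * s" "v = x * r' + y * s'" by (auto simp: pair_ideal_def)
  then show ?thesis
    by (intro pair_idealI[of "r + r'" "s + s'"] OK_add) (simp_all add: algebra_simps)
qed

lemma pair_ideal_mult: "c \<in> OK \<Longrightarrow> u \<in> pair_ideal x y \<Longrightarrow> c * u \<in> pair_ideal x y"
proof -
  assume c: "c \<in> OK" and "u \<in> pair_ideal x y"
  then obtain r s where h: "r \<in> OK" "s \<in> OK" "u = x * r + y * s" by (auto simp: pair_ideal_def)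
  then show ?thesis
    using c by (intro pair_idealI[of "c * r" "c * s"] OK_mult) (simp_all add: algebra_simps)
qed

lemma pair_ideal_fst: "x \<in> pair_ideal x y" and pair_ideal_snd: "y \<in> pair_ideal x y"
  by (rule pair_idealI[of 1 0]; simp add: OK_0 OK_1) (rule pair_idealI[of 0 1]; simp add: OK_0 OK_1)

lemma pair_ideal_subset_OK: "x \<in> OK \<Longrightarrow> y \<in> OK \<Longrightarrow> pair_ideal x y \<subseteq> OK"
  by (auto simp: pair_ideal_def intro!: OK_add OK_mult)

lemma fractional_ideal_pair_ideal:
  assumes "x \<in> OK" "y \<in> OK" "y \<noteq> 0"
  shows "fractional_ideal K (pair_ideal x y)"
proof -
  have "0 \<in> pair_ideal x y" using pair_ideal_mult[OF OK_0 pair_ideal_fst] by simp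
  moreover have "pair_ideal x y \<noteq> {0}" using pair_ideal_snd[of y x] assms(3) by auto
  moreover have "\<exists>d\<in>OK - {0}. \<forall>z\<in>pair_ideal x y. d * z \<in> OK"
    using OK_1 pair_ideal_subset_OK[OF assms(1,2)] by (intro bexI[of _ 1]) auto
  ultimately show ?thesis
    unfolding fractional_ideal_iff
    using pair_ideal_add pair_ideal_mult pair_ideal_subset_OK[OF assms(1,2)] OK_subset_K by blast
qed

lemma pair_ideal_prod_subset:
  assumes "x * u \<in> pair_ideal c d" "x * v \<in> pair_ideal c d" "y * u \<in> pair_ideal c d" "y * v \<in> pair_ideal c d"
  shows "ideal_prod complex_ring (pair_ideal x y) (pair_ideal u v) \<subseteq> pair_ideal c d"
proof (rule ideal_prod_least)
  fix z w assume "z \<in> pair_ideal x y" "w \<in> pair_ideal u v"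
  then obtain r s r' s' where h: "r \<in> OK" "s \<in> OK" "r' \<in> OK" "s' \<in> OK"
    "z = x * r + y * s" "w = u * r' + v * s'" by (auto simp: pair_ideal_def)
  have "z * w = (r * r') * (x * u) + (r * s') * (x * v) + (s * r') * (y * u) + (s * s') * (y * v)"
    by (simp add: h algebra_simps)
  also have "\<dots> \<in> pair_ideal c d"
    using h(1-4) assms pair_ideal_add pair_ideal_mult OK_mult by metis
  finally show "z * w \<in> pair_ideal c d" .
qed (rule pair_ideal_add)

text \<open>
  A unit \<open>e\<close> has norm \<open>1\<close>, so its trace \<open>t\<close> satisfies \<open>\<bar>t\<bar> \<le> 2\<close> and \<open>(e - cnj e)\<^sup>2 = t\<^sup>2 - 4\<close>. The
  hypotheses exclude the Gaussian field (\<open>t = 0\<close>) and the Eisenstein field (\<open>\<bar>t\<bar> = 1\<close>), the only imaginary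
  quadratic fields with further units.
\<close>

lemma unit_cases:
  assumes e: "e \<in> OK" "e' \<in> OK" "e * e' = 1"
    and gauss: "\<And>z. z\<^sup>2 \<noteq> - 4 * D" and eisenstein: "\<And>z. z\<^sup>2 \<noteq> - 3 * D"
  shows "e = 1 \<or> e = - 1"
proof -
  obtain N N' where N: "e * cnj e = of_int N" "e' * cnj e' = of_int N'"
    using e by (auto simp: mem_OK_iff elim!: Ints_cases)
  obtain t where t: "e + cnj e = of_int t"
    using e by (auto simp: mem_OK_iff elim!: Ints_cases)
  have N_norm: "real_of_int N = (cmod e)\<^sup>2"
    using N(1) complex_norm_square[of e] by (metis of_real_eq_iff of_real_of_int_eq of_real_power)
  have "of_int N * of_int N' = (e * e') * cnj (e * e')"
    unfolding N[symmetric] by (simp add: mult_ac)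
  then have "of_int (N * N') = (1::complex)" using e(3) by simp
  then have "N * N' = 1" by (simp only: of_int_eq_1_iff)
  moreover have "N \<ge> 0" using N_norm by (metis of_int_0_le_iff zero_le_power2)
  ultimately have N1: "N = 1" by (simp add: zmult_eq_1_iff)
  define \<delta> where "\<delta> = e - cnj e"
  have d2: "\<delta>\<^sup>2 = of_int (t\<^sup>2 - 4)"
  proof -
    have "\<delta>\<^sup>2 = (e + cnj e)\<^sup>2 - 4 * (e * cnj e)"
      by (simp add: \<delta>_def power2_eq_square algebra_simps)
    then show ?thesis unfolding t N N1 by simp
  qed
  have "\<delta> \<in> K" using e OK_subset_K K_cnj by (auto simp: \<delta>_def intro!: K_diff)
  then obtain r s where d: "\<delta> = of_real r + of_real s * sqrtD" "r \<in> \<rat>" "s \<in> \<rat>"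
    by (rule K_cases)
  have "Re \<delta> = 0" by (simp add: \<delta>_def)
  moreover have "Re sqrtD = 0" using cnj_sqrtD by (simp add: complex_eq_iff)
  ultimately have "r = 0" using d(1) by simp
  then have d_s: "\<delta> = of_real s * sqrtD" using d(1) by simp
  have "of_real (s\<^sup>2 * of_int D) = complex_of_real (of_int (t\<^sup>2 - 4))"
    using d2 unfolding d_s by (simp add: power_mult_distrib sqrtD_squared)
  then have s2: "s\<^sup>2 * of_int D = of_int (t\<^sup>2 - 4)" by (simp only: of_real_eq_iff)
  \<comment> \<open>Multiplying by \<open>D\<close> turns the rational square into an integral one.\<close>
  have sD2: "(s * of_int D)\<^sup>2 = of_int ((t\<^sup>2 - 4) * D)"
    using arg_cong[OF s2, of "\<lambda>x. x * of_int D"] by (simp add: power2_eq_square mult_ac)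
  have "s * of_int D \<in> \<int>"
  proof (rule rational_algebraic_int_is_int)
    show "algebraic_int (s * of_int D)"
    proof (rule algebraic_int_root)
      show "poly (Polynomial.monom 1 2) (s * of_int D) = of_int ((t\<^sup>2 - 4) * D)"
        using sD2 by (simp add: poly_monom)
      show "algebraic_int (real_of_int ((t\<^sup>2 - 4) * D))" by (rule algebraic_int_of_int)
    qed (simp_all add: Polynomial.degree_monom_eq)
  qed (use d in auto)
  then obtain z where "s * of_int D = of_int z" by (elim Ints_cases)
  then have "real_of_int (z\<^sup>2) = of_int ((t\<^sup>2 - 4) * D)" using sD2 by simp
  then have z: "z\<^sup>2 = (t\<^sup>2 - 4) * D" by (simp only: of_int_eq_iff)
  have "(t\<^sup>2 - 4) * D \<ge> 0" using z by (metis zero_le_power2)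
  then have "t\<^sup>2 \<le> 4" using D_neg by (simp add: zero_le_mult_iff)
  then have "\<bar>t\<bar> \<le> 2" using abs_le_square_iff[of t 2] by simp
  moreover have "t \<noteq> 0" using z gauss[of z] by auto
  moreover have "t \<noteq> 1" "t \<noteq> - 1" using z eisenstein[of z] by auto
  ultimately have "t = 2 \<or> t = - 2" by arith
  then have "t\<^sup>2 - 4 = 0" by auto
  then have "\<delta> = 0" using d2 by simp
  then have "2 * e = of_int t" using t by (simp add: \<delta>_def)
  then show ?thesis using \<open>t = 2 \<or> t = - 2\<close> by auto
qed

end

section \<open>An ideal class of order n\<close>

text \<open>
  The equation for \<open>D\<close> says that \<open>(a + sqrt D) / 2\<close> has trace \<open>a\<close> and norm \<open>p ^ n\<close>.
\<close>

locale power_norm = imaginary_quadratic_field D for D +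
  fixes a :: int and p n :: nat
  assumes D_eq: "D = a\<^sup>2 - 4 * int p ^ n"
    and n_pos: "0 < n"
    and coprime_a_p: "coprime a (int p)"
    and p_pos: "0 < p"
begin

definition \<alpha> :: complex where "\<alpha> = (of_int a + sqrtD) / 2"

lemma trace_\<alpha>: "\<alpha> + cnj \<alpha> = of_int a"
  by (simp add: \<alpha>_def cnj_sqrtD add_divide_distrib[symmetric])

lemma norm_\<alpha>: "\<alpha> * cnj \<alpha> = of_nat p ^ n"
proof -
  have "\<alpha> * cnj \<alpha> = ((of_int a)\<^sup>2 - sqrtD\<^sup>2) / 4"
    by (simp add: \<alpha>_def cnj_sqrtD algebra_simps power2_eq_square)
  also have "sqrtD\<^sup>2 = (of_int a)\<^sup>2 - 4 * of_nat p ^ n"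
    unfolding sqrtD_squared by (subst D_eq) simp
  finally show ?thesis by simp
qed

lemma \<alpha>_nz: "\<alpha> \<noteq> 0"
  using norm_\<alpha> p_pos by auto

lemma \<alpha>_in_OK: "\<alpha> \<in> OK"
proof -
  have "\<alpha> \<in> K"
    using K_divide[OF K_add[OF K_of_int sqrtD_in_K] K_of_int[of 2]] by (simp add: \<alpha>_def)
  then show ?thesis
    by (simp add: mem_OK_iff trace_\<alpha> norm_\<alpha>)
qed

lemma OK_p: "of_nat p ^ k \<in> OK"
  using OK_power[OF OK_of_int[of "int p"]] by simp

text \<open>
  When \<open>p\<close> is prime, it splits in \<open>K\<close> and \<open>J 1\<close> is one of the two primes above it. The ideals \<open>J k\<close> turn
  out to be its powers; having them in closed form avoids computing generators of an ideal power.
\<close>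

definition J :: "nat \<Rightarrow> complex set" where "J k = pair_ideal (of_nat p ^ k) \<alpha>"

lemma fractional_ideal_J: "fractional_ideal K (J k)"
  unfolding J_def by (rule fractional_ideal_pair_ideal[OF OK_p \<alpha>_in_OK \<alpha>_nz])

text \<open>
  Only the membership of \<open>\<alpha>\<close> in the product is not visible from the generators. Since the trace \<open>a\<close> and the
  norm \<open>p ^ n\<close> of \<open>\<alpha>\<close> are coprime, \<open>1 = r * a + s * p ^ n\<close>. Multiplying by \<open>\<alpha>\<close> and using
  \<open>a = \<alpha> + cnj \<alpha>\<close> writes \<open>\<alpha>\<close> as a combination of \<open>\<alpha>\<^sup>2\<close> and \<open>p ^ n\<close>, which both lie in the product as long
  as \<open>k < n\<close>.
\<close>

lemma J_prod:
  assumes "k < n"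
  shows "ideal_prod complex_ring (J k) (J 1) = J (Suc k)"
proof
  have mem: "of_nat p ^ k * \<alpha> \<in> J (Suc k)" "\<alpha> * of_nat p ^ 1 \<in> J (Suc k)" "\<alpha> * \<alpha> \<in> J (Suc k)"
    using pair_ideal_mult[OF OK_p[of k] pair_ideal_snd] pair_ideal_mult[OF OK_p[of 1] pair_ideal_snd]
      pair_ideal_mult[OF \<alpha>_in_OK pair_ideal_snd]
    unfolding J_def by (simp_all only: mult.commute[of \<alpha> "of_nat p ^ 1"])
  moreover have "of_nat p ^ k * of_nat p ^ 1 \<in> J (Suc k)"
    using pair_ideal_fst[of "of_nat p ^ Suc k" \<alpha>] by (simp add: J_def mult.commute)
  ultimately show "ideal_prod complex_ring (J k) (J 1) \<subseteq> J (Suc k)"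
    unfolding J_def by (intro pair_ideal_prod_subset) auto
  define P where "P = ideal_prod complex_ring (J k) (J 1)"
  have P: "u + v \<in> P" "c * u \<in> P" if "u \<in> P" "v \<in> P" "c \<in> OK" for u v c
    using fractional_ideal_prod[OF fractional_ideal_J fractional_ideal_J] that
    unfolding P_def fractional_ideal_iff by blast+
  have pk: "of_nat p ^ Suc k \<in> P"
    using ideal_prod_mult_mem[of "of_nat p ^ k" "J k" "of_nat p ^ 1" "J 1"] pair_ideal_fst
    by (simp add: P_def J_def mult.commute)
  have \<alpha>2: "\<alpha> * \<alpha> \<in> P"
    using ideal_prod_mult_mem[of \<alpha> "J k" \<alpha> "J 1"] pair_ideal_snd by (simp add: P_def J_def)
  have "coprime a (int p ^ n)" using coprime_a_p by simp
  then obtain r s where "r * a + s * int p ^ n = 1"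
    using bezout_int by (metis coprime_imp_gcd_eq_1)
  then have rs: "of_int r * of_int a + of_int s * of_nat p ^ n = (1::complex)"
    by (metis of_int_1 of_int_add of_int_mult of_int_of_nat_eq of_int_power)
  have "n = (n - Suc k) + Suc k" using assms by simp
  then have pn: "of_nat p ^ n = of_nat p ^ (n - Suc k) * (of_nat p ^ Suc k :: complex)"
    by (metis power_add)
  have "\<alpha> = (of_int r * of_int a + of_int s * of_nat p ^ n) * \<alpha>" using rs by simp
  also have "\<dots> = of_int r * (\<alpha> * \<alpha>) + (of_int r + of_int s * \<alpha>) * (\<alpha> * cnj \<alpha>)"
    unfolding trace_\<alpha>[symmetric] norm_\<alpha>[symmetric] by (simp add: algebra_simps)
  also have "\<dots> = of_int r * (\<alpha> * \<alpha>) + ((of_int r + of_int s * \<alpha>) * of_nat p ^ (n - Suc k)) * of_nat p ^ Suc k"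
    unfolding norm_\<alpha> pn by (simp add: mult.assoc)
  also have "\<dots> \<in> P"
    by (intro P(1)[OF _ _ OK_1] P(2)[OF _ pk] P(2)[OF _ \<alpha>2] \<alpha>2 pk OK_mult OK_add OK_of_int \<alpha>_in_OK OK_p)
  finally have \<alpha>P: "\<alpha> \<in> P" .
  show "J (Suc k) \<subseteq> ideal_prod complex_ring (J k) (J 1)"
  proof
    fix z assume "z \<in> J (Suc k)"
    then obtain r s where "r \<in> OK" "s \<in> OK" "z = r * of_nat p ^ Suc k + s * \<alpha>"
      by (auto simp: J_def pair_ideal_def mult.commute)
    then show "z \<in> ideal_prod complex_ring (J k) (J 1)"
      unfolding P_def[symmetric] using P pk \<alpha>P OK_1 by metis
  qed
qed

text \<open>
  The generator \<open>p ^ n\<close> is redundant, being the multiple \<open>\<alpha> * cnj \<alpha>\<close> of \<open>\<alpha>\<close>.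
\<close>

lemma J_n: "J n = principal_fractional_ideal K \<alpha>"
proof
  show "J n \<subseteq> principal_fractional_ideal K \<alpha>"
  proof
    fix z assume "z \<in> J n"
    then obtain r s where rs: "r \<in> OK" "s \<in> OK" "z = of_nat p ^ n * r + \<alpha> * s"
      by (auto simp: J_def pair_ideal_def)
    then have "z = \<alpha> * (cnj \<alpha> * r + s)"
      by (simp add: norm_\<alpha>[symmetric] algebra_simps)
    moreover have "cnj \<alpha> * r + s \<in> OK"
      using rs by (intro OK_add OK_mult OK_cnj \<alpha>_in_OK)
    ultimately show "z \<in> principal_fractional_ideal K \<alpha>"
      by (auto simp: principal_fractional_ideal_def)
  qed
  show "principal_fractional_ideal K \<alpha> \<subseteq> J n"
    using pair_ideal_mult[OF _ pair_ideal_snd] by (auto simp: principal_fractional_ideal_def J_def mult.commute)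
qed

lemma J_pow:
  assumes "k \<le> n"
  shows "J 1 [^]\<^bsub>fractional_ideal_group K\<^esub> k = J k"
  using assms
proof (induction k)
  case 0
  have "J 0 = OK"
    using pair_ideal_subset_OK[OF OK_1 \<alpha>_in_OK] pair_ideal_mult[OF _ pair_ideal_fst, of _ 1 \<alpha>]
    by (auto simp: J_def)
  then show ?case by simp (simp add: fractional_ideal_group_def)
next
  case (Suc k)
  then show ?case using J_prod[of k] by simp (simp add: fractional_ideal_group_def)
qed

text \<open>
  If \<open>J m\<close> is generated by \<open>\<beta>\<close>, then \<open>\<beta> ^ e\<close> and \<open>\<alpha>\<close> generate the same ideal \<open>J n\<close> and differ by a unit.
  The only units are \<open>1\<close> and \<open>- 1\<close>, and a sign can be moved into \<open>\<beta>\<close> because \<open>e\<close> is odd.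
\<close>

lemma power_eq_\<alpha>_if_J_principal:
  assumes m: "0 < m" "n = m * e" and "odd n"
    and princ: "J m = principal_fractional_ideal K \<beta>"
    and gauss: "\<And>z. z\<^sup>2 \<noteq> - 4 * D" and eisenstein: "\<And>z. z\<^sup>2 \<noteq> - 3 * D"
  shows "\<exists>\<gamma>\<in>OK. \<gamma> ^ e = \<alpha>"
proof -
  have "e > 0" using m n_pos by (cases e) auto
  have "odd e" using m \<open>odd n\<close> by simp
  have J1: "J 1 \<in> carrier (fractional_ideal_group K)"
    using fractional_ideal_J by (simp add: fractional_ideal_group_def)
  have \<beta>: "\<beta> \<in> OK"
    using pair_ideal_subset_OK[OF OK_p \<alpha>_in_OK, of m] OK_1
    unfolding J_def[symmetric] princ by (force simp: principal_fractional_ideal_def)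
  have "principal_fractional_ideal K \<alpha> = J 1 [^]\<^bsub>fractional_ideal_group K\<^esub> (m * e)"
    using J_pow[of n] J_n m by simp
  also have "\<dots> = (J 1 [^]\<^bsub>fractional_ideal_group K\<^esub> m) [^]\<^bsub>fractional_ideal_group K\<^esub> e"
    using J1 by (simp add: ideals.nat_pow_pow)
  also have "\<dots> = principal_fractional_ideal K (\<beta> ^ e)"
    using J_pow[of m] m \<open>e > 0\<close> princ principal_pow by simp
  finally have eq: "principal_fractional_ideal K \<alpha> = principal_fractional_ideal K (\<beta> ^ e)" .
  have self: "x \<in> principal_fractional_ideal K x" for x
    using OK_1 by (force simp: principal_fractional_ideal_def)
  obtain u where u: "u \<in> OK" "\<alpha> = \<beta> ^ e * u"
    using self[of \<alpha>] unfolding eq by (auto simp: principal_fractional_ideal_def)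
  obtain v where v: "v \<in> OK" "\<beta> ^ e = \<alpha> * v"
    using self[of "\<beta> ^ e"] unfolding eq[symmetric] by (auto simp: principal_fractional_ideal_def)
  have "\<alpha> * (u * v) = \<alpha> * 1" using u v by (simp add: mult_ac)
  then have "u * v = 1" using \<alpha>_nz mult_left_cancel by blast
  then have "u = 1 \<or> u = - 1" using unit_cases u v gauss eisenstein by blast
  then have "(\<beta> * u) ^ e = \<alpha>" "\<beta> * u \<in> OK"
    using u \<open>odd e\<close> \<beta> OK_mult by (auto simp: power_mult_distrib)
  then show ?thesis by blast
qed

text \<open>
  Comparing norms, \<open>\<gamma>\<close> has norm \<open>p ^ m\<close>; comparing traces, the power sum of \<open>\<gamma>\<close> and its conjugate is
  \<open>a\<close>.
\<close>

lemma odd_power_sum_if_power_eq_\<alpha>: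
  assumes \<gamma>: "\<gamma> \<in> OK" "\<gamma> ^ e = \<alpha>" and m: "n = m * e" and e: "e = 2 * j + 1"
  shows "\<exists>u. u * poly (odd_power_sum_poly u j) (int p ^ m) = a"
proof -
  obtain u N where u: "\<gamma> + cnj \<gamma> = of_int u" and N: "\<gamma> * cnj \<gamma> = of_int N"
    using \<gamma> by (auto simp: mem_OK_iff elim!: Ints_cases)
  have N_norm: "real_of_int N = (cmod \<gamma>)\<^sup>2"
    using N complex_norm_square[of \<gamma>] by (metis of_real_eq_iff of_real_of_int_eq of_real_power)
  then have "N \<ge> 0" by (metis of_int_0_le_iff zero_le_power2)
  have "of_int (N ^ e) = \<alpha> * cnj \<alpha>"
    unfolding of_int_power N[symmetric] \<gamma>(2)[symmetric] by (simp add: power_mult_distrib)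
  also have "\<dots> = of_int ((int p ^ m) ^ e)" by (simp add: norm_\<alpha> m power_mult)
  finally have "N ^ e = (int p ^ m) ^ e" by (simp only: of_int_eq_iff)
  then have N_eq: "N = int p ^ m"
    using \<open>N \<ge> 0\<close> e by (metis power_eq_imp_eq_base add_gr_0 less_one of_nat_0_le_iff zero_le_power)
  have "of_int a = \<gamma> ^ e + cnj \<gamma> ^ e"
    using trace_\<alpha> \<gamma> by (metis complex_cnj_power)
  also have "\<dots> = of_int (u * poly (odd_power_sum_poly u j) N)"
    unfolding e by (rule odd_power_sum[OF u N])
  finally show ?thesis unfolding N_eq of_int_eq_iff by metis
qed

text \<open>
  If the class of \<open>J 1\<close> had a smaller order \<open>m\<close>, then \<open>\<alpha>\<close> would be a power with the odd exponent
  \<open>n / m = 2 * j + 1\<close>, contrary to the last assumption.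
\<close>

lemma class_group_cyclic_subgroup:
  assumes "odd n" and gauss: "\<And>z. z\<^sup>2 \<noteq> - 4 * D" and eisenstein: "\<And>z. z\<^sup>2 \<noteq> - 3 * D"
    and generic: "\<And>j m u. 0 < j \<Longrightarrow> 0 < m \<Longrightarrow> n = m * (2 * j + 1) \<Longrightarrow>
      u * poly (odd_power_sum_poly u j) (int p ^ m) \<noteq> a"
  shows "\<exists>H. subgroup H (class_group K) \<and> (class_group K)\<lparr>carrier := H\<rparr> \<cong> integer_mod_group n"
  unfolding class_group_def
proof (rule principals.cyclic_subgroup_Mod[OF _ n_pos])
  show "J 1 \<in> carrier (fractional_ideal_group K)"
    using fractional_ideal_J by (simp add: fractional_ideal_group_def)
  show "J 1 [^]\<^bsub>fractional_ideal_group K\<^esub> n \<in> {principal_fractional_ideal K x | x. x \<in> K - {0}}"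
    using J_pow[of n] J_n \<alpha>_in_OK \<alpha>_nz OK_subset_K by auto
  fix m assume m: "0 < m" "m < n" "m dvd n"
  then obtain e where e: "n = m * e" by blast
  have "odd e" using e \<open>odd n\<close> by simp
  then obtain j where j: "e = 2 * j + 1" by (elim oddE)
  have "0 < j" using j e m by (cases j) auto
  show "J 1 [^]\<^bsub>fractional_ideal_group K\<^esub> m \<notin> {principal_fractional_ideal K x | x. x \<in> K - {0}}"
  proof
    assume "J 1 [^]\<^bsub>fractional_ideal_group K\<^esub> m \<in> {principal_fractional_ideal K x | x. x \<in> K - {0}}"
    then obtain \<beta> where "J m = principal_fractional_ideal K \<beta>" using J_pow[of m] m by auto
    then obtain \<gamma> where "\<gamma> \<in> OK" "\<gamma> ^ e = \<alpha>"
      using power_eq_\<alpha>_if_J_principal m(1) e \<open>odd n\<close> gauss eisenstein by blast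
    then show False
      using odd_power_sum_if_power_eq_\<alpha> e j generic \<open>0 < j\<close> m(1) by blast
  qed
qed

end

section \<open>Excluding the Gaussian and Eisenstein fields\<close>

text \<open>
  Otherwise \<open>w\<^sup>2 + a\<^sup>2 = 4 * p ^ n\<close> for some \<open>w\<close>, which is impossible modulo \<open>4\<close> for odd \<open>a\<close>.
\<close>

lemma discriminant_not_minus_square:
  fixes a z :: int
  assumes "odd a"
  shows "z\<^sup>2 \<noteq> - 4 * (a\<^sup>2 - 4 * int p ^ n)"
proof
  assume z: "z\<^sup>2 = - 4 * (a\<^sup>2 - 4 * int p ^ n)"
  then have "even (z\<^sup>2)" by simp
  then obtain w where "z = 2 * w" by auto
  then have w: "w\<^sup>2 = 4 * int p ^ n - a\<^sup>2" using z by (simp add: power_mult_distrib)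
  have sq: "x\<^sup>2 mod 4 = (if even x then 0 else 1)" for x :: int
  proof -
    have "x mod 4 = 0 \<or> x mod 4 = 1 \<or> x mod 4 = 2 \<or> x mod 4 = 3" by presburger
    moreover have "x\<^sup>2 mod 4 = ((x mod 4) * (x mod 4)) mod 4"
      by (simp add: mod_mult_eq power2_eq_square)
    moreover have "even x \<longleftrightarrow> even (x mod 4)" by presburger
    ultimately show ?thesis by auto
  qed
  have "(w\<^sup>2 + a\<^sup>2) mod 4 = 0" using w by simp
  then show False
    using sq[of w] sq[of a] \<open>odd a\<close> by presburger
qed

text \<open>
  Otherwise \<open>a\<^sup>2 + 3 * w\<^sup>2 = 4 * p ^ n\<close> for some \<open>w\<close>, which makes \<open>p ^ n\<close> a square modulo \<open>3\<close>. This is the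
  reason for restricting to primes \<open>p\<close> that are \<open>2\<close> modulo \<open>3\<close>: the Eisenstein field has class number \<open>1\<close>
  and has to be avoided.
\<close>

lemma discriminant_not_minus_3_square:
  fixes a z :: int
  assumes "p mod 3 = 2" "odd n"
  shows "z\<^sup>2 \<noteq> - 3 * (a\<^sup>2 - 4 * int p ^ n)"
proof
  assume z: "z\<^sup>2 = - 3 * (a\<^sup>2 - 4 * int p ^ n)"
  then have "3 dvd z\<^sup>2" by simp
  then have "3 dvd z" by (simp add: prime_dvd_power_iff)
  then obtain w where "z = 3 * w" by blast
  then have w: "3 * w\<^sup>2 = 4 * int p ^ n - a\<^sup>2" using z by (simp add: power_mult_distrib)
  have sq: "x\<^sup>2 mod 3 = 0 \<or> x\<^sup>2 mod 3 = 1" for x :: int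
  proof -
    have "x mod 3 = 0 \<or> x mod 3 = 1 \<or> x mod 3 = 2" by presburger
    moreover have "x\<^sup>2 mod 3 = ((x mod 3) * (x mod 3)) mod 3"
      by (simp add: mod_mult_eq power2_eq_square)
    ultimately show ?thesis by auto
  qed
  have p: "int p mod 3 = 2" using assms(1) by presburger
  have "int p ^ (2 * k + 1) mod 3 = 2" for k
  proof (induction k)
    case (Suc k)
    have "int p ^ (2 * Suc k + 1) = (int p * int p) * int p ^ (2 * k + 1)" by simp
    also have "\<dots> mod 3 = (((int p mod 3) * (int p mod 3)) mod 3 * (int p ^ (2 * k + 1) mod 3)) mod 3"
      by (simp only: mod_mult_eq)
    finally show ?case unfolding p Suc by simp
  qed (use p in simp)
  then have "int p ^ n mod 3 = 2" using \<open>odd n\<close> by (metis oddE)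
  then show False using w sq[of a] by presburger
qed

section \<open>The class groups\<close>

theorem theorem1p2:
  fixes a :: int and n :: nat
  assumes "a \<ge> 1" and "odd a" and "n > 1" and "odd n"
  shows "infinite {p :: nat. Factorial_Ring.prime p \<and>
           imaginary_quadratic (K_field a (int p) n) \<and>
           (\<exists>H. subgroup H (class_group (K_field a (int p) n)) \<and>
                (class_group (K_field a (int p) n))\<lparr>carrier := H\<rparr> \<cong> integer_mod_group n)}"
    (is "infinite ?S")
proof -
  \<comment> \<open>Outside this finite set no \<open>p ^ m\<close> is the norm of an integer whose odd power of exponent
    \<open>2 * j + 1 \<ge> 3\<close> has trace \<open>a\<close>.\<close>
  define bad :: "nat set" where "bad = (\<Union>m\<in>{1..n}. \<Union>j\<in>{1..n}.
      (\<lambda>p. int p ^ m) -` {N. \<exists>u. u * poly (odd_power_sum_poly u j) N = a})"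
  define good where "good = {p::nat. Factorial_Ring.prime p \<and> p mod 3 = 2} - bad - {..nat a}"
  have "finite bad"
    unfolding bad_def using assms
    by (intro finite_UN_I finite_vimageI finite_odd_power_sum_eq)
      (auto intro!: injI simp: power_eq_iff_eq_base)
  then have "infinite good"
    unfolding good_def using infinite_primes_2_mod_3 by (intro Diff_infinite_finite) auto
  moreover have "good \<subseteq> ?S"
  proof
    fix p assume "p \<in> good"
    then have p: "Factorial_Ring.prime p" "p mod 3 = 2" "p \<notin> bad" "a < int p"
      by (auto simp: good_def)
    define D where "D = a\<^sup>2 - 4 * int p ^ n"
    have "a\<^sup>2 \<le> int p ^ 2" using p assms by (intro power_mono) auto
    moreover have "int p ^ 2 \<le> int p ^ n" using assms prime_ge_1_nat[OF p(1)] by (intro power_increasing) auto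
    moreover have "0 < int p ^ n" using prime_gt_0_nat[OF p(1)] by simp
    ultimately have "D < 0" unfolding D_def by linarith
    moreover have "coprime a (int p)"
    proof -
      have "\<not> int p dvd a" using p assms zdvd_not_zless[of a "int p"] by auto
      then show ?thesis
        using p(1) prime_imp_coprime[of "int p" a] by (simp add: coprime_commute)
    qed
    ultimately interpret power_norm D a p n
      using assms prime_gt_0_nat[OF p(1)] by unfold_locales (auto simp: D_def)
    have K: "K_field a (int p) n = K" by (simp add: K_field_def D_def)
    have "\<exists>H. subgroup H (class_group K) \<and> (class_group K)\<lparr>carrier := H\<rparr> \<cong> integer_mod_group n"
    proof (rule class_group_cyclic_subgroup)
      fix j m :: nat and u
      assume h: "0 < j" "0 < m" "n = m * (2 * j + 1)"
      have "1 * (2 * j + 1) \<le> m * (2 * j + 1)" "m * 1 \<le> m * (2 * j + 1)"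
        using h(2) by (intro mult_le_mono; simp)+
      then have "1 * (2 * j + 1) \<le> n" "m * 1 \<le> n" unfolding h(3)[symmetric] .
      then have "j \<le> n" "m \<le> n" by simp_all
      then show "u * poly (odd_power_sum_poly u j) (int p ^ m) \<noteq> a"
        using p(3) h by (auto simp: bad_def)
    next
      show "z\<^sup>2 \<noteq> - 4 * D" "z\<^sup>2 \<noteq> - 3 * D" for z
        unfolding D_def
        using discriminant_not_minus_square[OF \<open>odd a\<close>]
          discriminant_not_minus_3_square[OF p(2) \<open>odd n\<close>] by blast+
    qed (use assms in simp)
    moreover have "imaginary_quadratic K" using D_neg by (auto simp: imaginary_quadratic_def)
    ultimately show "p \<in> ?S" using p by (simp add: K)
  qed
  ultimately show ?thesis using infinite_super by blast
qed

end
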